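(* Let $d\ge 2$ be an integer and fix $a, b \in \mathbb{R}^d$ satisfying $\bar a_k > 0$ and $\bar b_k>0$ for $k=2,\dots,d$. Let $f:\nabla^{d-1} \to \mathbb{R}$ be a function that is integrable under $\mathbb{P}_a$. Then $$\mathbb{E}_a[f(Y)] = \frac{\mathbb{E}_{b}\left[f(Y)\prod_{k=1}^d Y_k^{a_k - b_k}\right]}{\mathbb{E}_{b}\left[\prod_{k=1}^d Y_k^{a_k - b_k}\right]}.$$
   Context: For a vector $v \in \mathbb{R}^d$, write $\bar v_k := v_k + v_{k+1} + \dots + v_d$ for its tail sums, $k=1,\dots,d$. The ordered simplex is $\nabla^{d-1} = \{y \in \mathbb{R}^d: y_1 \geq y_2\geq \dots \geq y_d \geq 0,\ y_1+\dots+y_d = 1\}$. Integrals $dy$ over $\nabla^{d-1}$ are with respect to the pushforward of Lebesgue measure on $\mathbb{R}^{d-1}$ under $(y_1,\dots,y_{d-1}) \mapsto (y_1,\dots,y_{d-1},1-y_1-\dots-y_{d-1})$. For $a \in \mathbb{R}^d$ with $\bar a_k>0$ for $k=2,\dots,d$, the constant $Q_a = \int_{\nabla^{d-1}}\prod_{k=1}^d y_k^{a_k-1}\,dy$ is finite (known fact), and the Generalized Rank Dirichlet distribution GRD$(a)$ is the probability measure $\mathbb{P}_a(A) = Q_a^{-1}\int_{\nabla^{d-1}} \prod_{k=1}^d y_k^{a_k-1} 1_A(y)\,dy$ on Borel subsets $A$ of $\nabla^{d-1}$. $\mathbb{E}_a$ denotes expectation under $\mathbb{P}_a$, and $Y=(Y_1,\dots,Y_d)$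 is a random vector with law $\mathbb{P}_a$ under $\mathbb{P}_a$ (e.g. the identity map on $\nabla^{d-1}$). Note $Y_d>0$ almost surely, so real powers of the $Y_k$ are well defined almost surely. *)

theory Defs
  imports "HOL-Probability.Probability"
begin

text \<open>Vectors in \<open>\<real>\<^sup>d\<close> are functions \<open>nat \<Rightarrow> real\<close> read at the indices \<open>1, \<dots>, d\<close>; as points
  of a measurable space they are the elements of \<open>{1..d} \<rightarrow>\<^sub>E UNIV\<close> with the product (that is,
  Borel) \<open>\<sigma>\<close>-algebra.\<close>

definition tail_sum :: "nat \<Rightarrow> (nat \<Rightarrow> real) \<Rightarrow> nat \<Rightarrow> real" where
  "tail_sum d v k = (\<Sum>j=k..d. v j)"

definition ordered_simplex :: "nat \<Rightarrow> (nat \<Rightarrow> real) set" where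
  "ordered_simplex d =
     {y \<in> {1..d} \<rightarrow>\<^sub>E UNIV. (\<forall>k\<in>{1..<d}. y k \<ge> y (Suc k)) \<and> y d \<ge> 0 \<and> (\<Sum>k=1..d. y k) = 1}"

definition simplex_chart :: "nat \<Rightarrow> (nat \<Rightarrow> real) \<Rightarrow> nat \<Rightarrow> real" where
  "simplex_chart d x = (\<lambda>k\<in>{1..d}. if k < d then x k else 1 - (\<Sum>j=1..<d. x j))"

definition simplex_measure :: "nat \<Rightarrow> (nat \<Rightarrow> real) measure" where
  "simplex_measure d =
     restrict_space
       (distr (\<Pi>\<^sub>M k\<in>{1..<d}. lborel) (\<Pi>\<^sub>M k\<in>{1..d}. borel) (simplex_chart d))
       (ordered_simplex d)"

text \<open>For \<open>y \<in> ordered_simplex d\<close> with \<open>y d = 0\<close> the powers below take the value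
  \<open>0 powr r = 0\<close>; these points form a null set of \<open>simplex_measure d\<close>.\<close>

definition GRD_weight :: "nat \<Rightarrow> (nat \<Rightarrow> real) \<Rightarrow> (nat \<Rightarrow> real) \<Rightarrow> real" where
  "GRD_weight d a y = (\<Prod>k=1..d. y k powr (a k - 1))"

definition GRD_const :: "nat \<Rightarrow> (nat \<Rightarrow> real) \<Rightarrow> ennreal" where
  "GRD_const d a = (\<integral>\<^sup>+ y. ennreal (GRD_weight d a y) \<partial>simplex_measure d)"

definition GRD :: "nat \<Rightarrow> (nat \<Rightarrow> real) \<Rightarrow> (nat \<Rightarrow> real) measure" where
  "GRD d a = density (simplex_measure d) (\<lambda>y. ennreal (GRD_weight d a y) / GRD_const d a)"

text \<open>The maps and sets used above are measurable, so \<open>distr\<close>, \<open>restrict_space\<close> and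
  \<open>density\<close> have their intended meaning.\<close>

lemma measurable_simplex_chart:
  "simplex_chart d \<in> (\<Pi>\<^sub>M k\<in>{1..<d}. lborel) \<rightarrow>\<^sub>M (\<Pi>\<^sub>M k\<in>{1..d}. borel)"
  unfolding simplex_chart_def
proof (rule measurable_restrict)
  fix k assume k: "k \<in> {1..d}"
  let ?M = "\<Pi>\<^sub>M k\<in>{1..<d}. (lborel :: real measure)"
  have comp: "(\<lambda>x. x j) \<in> borel_measurable ?M" if "j \<in> {1..<d}" for j
    using measurable_component_singleton[OF that, of "\<lambda>_. lborel :: real measure"]
    by (simp add: measurable_lborel1)
  show "(\<lambda>x. if k < d then x k else 1 - (\<Sum>j=1..<d. x j)) \<in> borel_measurable ?M"
  proof (cases "k < d")
    case True
    with k comp[of k] show ?thesis by simp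
  next
    case False
    have "(\<lambda>x. 1 - (\<Sum>j=1..<d. x j)) \<in> borel_measurable ?M"
      by (intro borel_measurable_diff borel_measurable_sum borel_measurable_const comp)
    with False show ?thesis by simp
  qed
qed

lemma ordered_simplex_in_sets:
  assumes "d \<ge> 2"
  shows "ordered_simplex d \<in> sets (\<Pi>\<^sub>M k\<in>{1..d}. borel)"
proof -
  let ?M = "\<Pi>\<^sub>M k\<in>{1..d}. (borel :: real measure)"
  have m: "(\<lambda>y. y k) \<in> borel_measurable ?M" if "k \<in> {1..d}" for k
    using that by (intro measurable_component_singleton)
  have "{y \<in> space ?M. (\<forall>k\<in>{1..<d}. y k \<ge> y (Suc k)) \<and> y d \<ge> 0 \<and> (\<Sum>k=1..d. y k) = 1} \<in> sets ?M"
    using assms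
    by (intro sets.sets_Collect_conj sets.sets_Collect_finite_All' borel_measurable_le
        borel_measurable_eq borel_measurable_sum borel_measurable_const m) auto
  then show ?thesis
    by (simp add: ordered_simplex_def space_PiM PiE_def)
qed

lemma measurable_GRD_density:
  "(\<lambda>y. ennreal (GRD_weight d a y) / GRD_const d a) \<in> borel_measurable (simplex_measure d)"
proof -
  have "(\<lambda>y. y k) \<in> borel_measurable (simplex_measure d)" if "k \<in> {1..d}" for k
    unfolding simplex_measure_def
    using measurable_component_singleton[OF that, of "\<lambda>_. borel :: real measure"]
    by (intro measurable_restrict_space1) simp
  then have "GRD_weight d a \<in> borel_measurable (simplex_measure d)"
    unfolding GRD_weight_def
    by (intro borel_measurable_prod powr_real_measurable borel_measurable_const)
  then show ?thesis by measurable
qed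

lemma space_GRD:
  "space (GRD d a) = ordered_simplex d"
  by (auto simp: GRD_def simplex_measure_def space_restrict_space space_PiM ordered_simplex_def)

end

theory Submission
  imports Defs
begin

text \<open>
  On the ordered simplex the weights satisfy \<open>w\<^sub>b(y) \<cdot> \<Prod> y\<^sub>k\<^bsup>a\<^sub>k - b\<^sub>k\<^esup> = w\<^sub>a(y)\<close>, so the identity is a
  cancellation of the constants \<open>Q\<^sub>a\<close> and \<open>Q\<^sub>b\<close> as soon as these are known to be positive and finite.
  For finiteness, choose \<open>\<epsilon> > 0\<close> so small that \<open>a - \<epsilon>\<close> still has nonnegative tail sums. Summation by
  parts in the exponents gives \<open>\<Prod>\<^bsub>k\<ge>2\<^esub> y\<^sub>k\<^bsup>a\<^sub>k - \<epsilon>\<^esup> \<le> 1\<close> on the ordered simplex, and \<open>y\<^sub>1 \<ge> 1/d\<close>, so that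
  \<open>w\<^sub>a\<close> is dominated by a multiple of the integrable product \<open>\<Prod>\<^bsub>k\<ge>2\<^esub> y\<^sub>k\<^bsup>\<epsilon> - 1\<^esup>\<close>.
\<close>

section \<open>Coordinates of points of the ordered simplex\<close>

lemma ordered_simplex_antimono:
  assumes y: "y \<in> ordered_simplex d" and "1 \<le> i" "i \<le> j" "j \<le> d"
  shows "y j \<le> y i"
  using assms(3,4)
proof (induction rule: dec_induct)
  case (step n)
  then have "n \<in> {1..<d}" using \<open>1 \<le> i\<close> by auto
  with y have "y (Suc n) \<le> y n" by (auto simp: ordered_simplex_def)
  with step show ?case by auto
qed simp

lemma ordered_simplex_nonneg:
  assumes y: "y \<in> ordered_simplex d" and k: "k \<in> {1..d}"
  shows "0 \<le> y k"
  using ordered_simplex_antimono[OF y, of k d] y k by (auto simp: ordered_simplex_def)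

lemma ordered_simplex_le_1:
  assumes y: "y \<in> ordered_simplex d" and k: "k \<in> {1..d}"
  shows "y k \<le> 1"
proof -
  have "y k \<le> (\<Sum>j=1..d. y j)"
    using k ordered_simplex_nonneg[OF y] by (intro member_le_sum) auto
  then show ?thesis using y by (simp add: ordered_simplex_def)
qed

lemma ordered_simplex_first_ge:
  assumes y: "y \<in> ordered_simplex d" and d: "d \<ge> 1"
  shows "1 / real d \<le> y 1"
proof -
  have "1 = (\<Sum>j=1..d. y j)" using y by (simp add: ordered_simplex_def)
  also have "\<dots> \<le> (\<Sum>j=1..d. y 1)"
    by (intro sum_mono ordered_simplex_antimono[OF y]) auto
  finally show ?thesis using d by (simp add: field_simps)
qed

section \<open>Weights and integration in the chart\<close>

lemma GRD_weight_nonneg: "0 \<le> GRD_weight d a y"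
  by (simp add: GRD_weight_def prod_nonneg)

lemma measurable_GRD_weight:
  "GRD_weight d a \<in> borel_measurable (\<Pi>\<^sub>M k\<in>{1..d}. borel)"
  unfolding GRD_weight_def
  by (intro borel_measurable_prod powr_real_measurable borel_measurable_const
      measurable_component_singleton)

lemma measurable_simplex_measure:
  assumes "f \<in> (\<Pi>\<^sub>M k\<in>{1..d}. borel) \<rightarrow>\<^sub>M N"
  shows "f \<in> simplex_measure d \<rightarrow>\<^sub>M N"
  unfolding simplex_measure_def using assms by (intro measurable_restrict_space1) simp

lemma space_simplex_measure: "space (simplex_measure d) = ordered_simplex d"
  using space_GRD[of d a] by (simp add: GRD_def)

text \<open>Since \<open>0 powr r = 0\<close> for every \<open>r\<close>, this holds on the faces of the simplex too.\<close>

lemma GRD_weight_mult_powr: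
  assumes "y \<in> ordered_simplex d"
  shows "GRD_weight d b y * (\<Prod>k=1..d. y k powr (a k - b k)) = GRD_weight d a y"
  using ordered_simplex_nonneg[OF assms]
  by (auto simp: GRD_weight_def prod.distrib[symmetric] powr_add[symmetric] intro!: prod.cong)

text \<open>Finiteness and positivity of the constants are both proved in these \<open>d - 1\<close>
  free coordinates, where Lebesgue measure is a product: Tonelli gives the first, a box of positive
  volume the second.\<close>

lemma nn_integral_simplex_measure:
  assumes d: "d \<ge> 2" and f: "f \<in> borel_measurable (\<Pi>\<^sub>M k\<in>{1..d}. borel)"
  shows "(\<integral>\<^sup>+ y. f y \<partial>simplex_measure d) =
    (\<integral>\<^sup>+ x. f (simplex_chart d x) * indicator (ordered_simplex d) (simplex_chart d x)
      \<partial>(\<Pi>\<^sub>M k\<in>{1..<d}. lborel))"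
proof -
  note S = ordered_simplex_in_sets[OF d]
  have "(\<integral>\<^sup>+ y. f y \<partial>simplex_measure d) =
    (\<integral>\<^sup>+ y. f y * indicator (ordered_simplex d) y
      \<partial>distr (\<Pi>\<^sub>M k\<in>{1..<d}. lborel) (\<Pi>\<^sub>M k\<in>{1..d}. borel) (simplex_chart d))"
    unfolding simplex_measure_def
    using S sets.sets_into_space[OF S] by (subst nn_integral_restrict_space) (auto simp: Int_absorb2)
  also have "\<dots> = (\<integral>\<^sup>+ x. f (simplex_chart d x) * indicator (ordered_simplex d) (simplex_chart d x)
      \<partial>(\<Pi>\<^sub>M k\<in>{1..<d}. lborel))"
    using f S by (intro nn_integral_distr measurable_simplex_chart) auto
  finally show ?thesis .
qed

section \<open>Finiteness of the normalizing constant\<close>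

text \<open>Summation by parts in multiplicative form, from the last index downwards: the power of
  \<open>y (Suc n)\<close> collected so far has a nonnegative exponent, so its base may be raised to
  \<open>y n\<close> and the result merged with the factor at \<open>n\<close>.\<close>

lemma prod_powr_le_powr_tail_sum:
  assumes anti: "\<And>k. m \<le> k \<Longrightarrow> k < d \<Longrightarrow> y (Suc k) \<le> y k"
    and pos: "\<And>k. m \<le> k \<Longrightarrow> k \<le> d \<Longrightarrow> 0 < y k"
    and tail: "\<And>k. m < k \<Longrightarrow> k \<le> d \<Longrightarrow> 0 \<le> tail_sum d c k"
    and md: "m \<le> d"
  shows "(\<Prod>k=m..d. y k powr c k) \<le> y m powr tail_sum d c m"
  using md anti pos tail
proof (induction rule: inc_induct)
  case base
  then show ?case by (simp add: tail_sum_def)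
next
  case (step n)
  have "(\<Prod>k=n..d. y k powr c k) = y n powr c n * (\<Prod>k=Suc n..d. y k powr c k)"
    using step.hyps by (simp add: prod.atLeast_Suc_atMost)
  also have "\<dots> \<le> y n powr c n * y (Suc n) powr tail_sum d c (Suc n)"
    using step by (intro mult_left_mono) auto
  also have "\<dots> \<le> y n powr c n * y n powr tail_sum d c (Suc n)"
    using step.hyps step.prems(1)[of n] step.prems(2)[of "Suc n"] step.prems(3)[of "Suc n"]
    by (intro mult_left_mono powr_mono2) auto
  also have "\<dots> = y n powr tail_sum d c n"
    using step.hyps by (simp add: tail_sum_def powr_add[symmetric] sum.atLeast_Suc_atMost)
  finally show ?case .
qed

lemma GRD_weight_le:
  assumes d: "d \<ge> 2" and y: "y \<in> ordered_simplex d" and "0 < y d"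
    and tail: "\<And>k. k \<in> {2..d} \<Longrightarrow> 0 \<le> tail_sum d (\<lambda>j. a j - \<epsilon>) k"
  shows "GRD_weight d a y \<le> real d powr \<bar>a 1 - 1\<bar> * (\<Prod>k=2..d. y k powr (\<epsilon> - 1))"
proof -
  have pos: "0 < y k" if "k \<in> {1..d}" for k
    using ordered_simplex_antimono[OF y, of k d] \<open>0 < y d\<close> that by auto
  have "(\<Prod>k=2..d. y k powr (a k - \<epsilon>)) \<le> y 2 powr tail_sum d (\<lambda>j. a j - \<epsilon>) 2"
    using d pos tail by (intro prod_powr_le_powr_tail_sum ordered_simplex_antimono[OF y]) auto
  also have "\<dots> \<le> 1"
    using d pos[of 2] ordered_simplex_le_1[OF y, of 2] tail[of 2] by (intro powr_le1) auto
  finally have *: "(\<Prod>k=2..d. y k powr (a k - \<epsilon>)) \<le> 1" .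
  \<comment> \<open>The exponent \<open>a 1 - 1\<close> may have either sign. Since
    \<open>y 1\<close> lies in (0,1], replacing the exponent by minus its absolute value can only
    increase the power, and then \<open>1 / y 1\<close> is at most \<open>d\<close>.\<close>
  have "y 1 powr (a 1 - 1) \<le> y 1 powr (- \<bar>a 1 - 1\<bar>)"
    using d pos[of 1] ordered_simplex_le_1[OF y, of 1] by (intro powr_mono') auto
  also have "\<dots> = (1 / y 1) powr \<bar>a 1 - 1\<bar>"
    using d pos[of 1] by (simp add: powr_minus_divide powr_divide)
  also have "\<dots> \<le> real d powr \<bar>a 1 - 1\<bar>"
    using d pos[of 1] ordered_simplex_first_ge[OF y]
    by (intro powr_mono2) (auto simp: field_simps)
  finally have 1: "y 1 powr (a 1 - 1) \<le> real d powr \<bar>a 1 - 1\<bar>" .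
  have "GRD_weight d a y = y 1 powr (a 1 - 1) * (\<Prod>k=2..d. y k powr (a k - 1))"
    using d by (simp add: GRD_weight_def prod.atLeast_Suc_atMost numeral_2_eq_2)
  also have "(\<Prod>k=2..d. y k powr (a k - 1)) =
      (\<Prod>k=2..d. y k powr (a k - \<epsilon>)) * (\<Prod>k=2..d. y k powr (\<epsilon> - 1))"
    by (simp add: prod.distrib[symmetric] powr_add[symmetric])
  also have "y 1 powr (a 1 - 1) * \<dots> \<le> real d powr \<bar>a 1 - 1\<bar> * (1 * (\<Prod>k=2..d. y k powr (\<epsilon> - 1)))"
    by (intro mult_mono 1 * order_refl mult_nonneg_nonneg prod_nonneg) auto
  finally show ?thesis by simp
qed

text \<open>Lowering every entry by \<epsilon> lowers each of these tail sums by at most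
  \<open>d\<close> times \<epsilon>, and finitely many positive tail sums have a positive
  minimum.\<close>

lemma ex_tail_sum_shift_nonneg:
  assumes tail: "\<And>k. k \<in> {2..d} \<Longrightarrow> 0 < tail_sum d a k"
  shows "\<exists>\<epsilon>>0. \<forall>k\<in>{2..d}. 0 \<le> tail_sum d (\<lambda>j. a j - \<epsilon>) k"
proof -
  \<comment> \<open>The extra element 1 keeps the set nonempty when \<open>{2..d}\<close> is
    empty.\<close>
  define m where "m = Min (insert 1 (tail_sum d a ` {2..d}))"
  have m: "0 < m" "\<And>k. k \<in> {2..d} \<Longrightarrow> m \<le> tail_sum d a k"
    using tail by (auto simp: m_def intro: Min_le simp del: Min_insert)
  have "0 \<le> tail_sum d (\<lambda>j. a j - m / (real d + 1)) k" if k: "k \<in> {2..d}" for k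
  proof -
    have "(\<Sum>j=k..d. m / (real d + 1)) = real (Suc d - k) * (m / (real d + 1))" by simp
    also have "\<dots> \<le> (real d + 1) * (m / (real d + 1))"
      using m(1) by (intro mult_right_mono) auto
    also have "\<dots> \<le> tail_sum d a k" using m(2)[OF k] by simp
    finally show ?thesis by (simp add: tail_sum_def sum_subtractf)
  qed
  then show ?thesis using m(1) by (intro exI[of _ "m / (real d + 1)"]) auto
qed

lemma nn_integral_powr_unit_interval:
  assumes "0 < \<epsilon>"
  shows "(\<integral>\<^sup>+ t. ennreal (t powr (\<epsilon> - 1)) * indicator {0..1} t \<partial>lborel) = ennreal (1 / \<epsilon>)"
  using has_integral_powr_from_0[of "\<epsilon> - 1" 1] assms
  by (intro nn_integral_has_integral_lebesgue') auto

lemma GRD_const_eq: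
  assumes "d \<ge> 2"
  shows "GRD_const d a = (\<integral>\<^sup>+ x. ennreal (GRD_weight d a (simplex_chart d x)) *
      indicator (ordered_simplex d) (simplex_chart d x) \<partial>(\<Pi>\<^sub>M k\<in>{1..<d}. lborel))"
  unfolding GRD_const_def using measurable_GRD_weight
  by (intro nn_integral_simplex_measure assms) measurable

text \<open>The dominating product involves the coordinates 2 to \<open>d\<close>, whereas the chart
  integrates over 1 to \<open>d - 1\<close>. The variable \<open>x 1\<close> enters only through the
  last coordinate, one minus the sum of all \<open>x j\<close>. Integrating over \<open>x 1\<close>
  first therefore gives \<open>1 / \<epsilon>\<close> whatever the other variables are, and the
  remaining factors separate.\<close>

lemma GRD_const_finite:
  assumes d: "d \<ge> 2" and tail: "\<And>k. k \<in> {2..d} \<Longrightarrow> 0 < tail_sum d a k"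
  shows "GRD_const d a < \<infinity>"
proof -
  obtain \<epsilon> where eps: "0 < \<epsilon>" and tail': "\<And>k. k \<in> {2..d} \<Longrightarrow> 0 \<le> tail_sum d (\<lambda>j. a j - \<epsilon>) k"
    using ex_tail_sum_shift_nonneg[OF tail] by blast
  define C where "C = real d powr \<bar>a 1 - 1\<bar>"
  \<comment> \<open>The cutoff makes \<open>g\<close> integrable over the whole line and changes
    nothing on the simplex, where all coordinates lie in [0,1].\<close>
  define g :: "real \<Rightarrow> ennreal" where "g t = ennreal (t powr (\<epsilon> - 1)) * indicator {0..1} t" for t
  have g_meas[measurable]: "g \<in> borel_measurable borel"
    unfolding g_def by measurable
  have g_int: "(\<integral>\<^sup>+ t. g t \<partial>lborel) = ennreal (1 / \<epsilon>)"
    unfolding g_def by (rule nn_integral_powr_unit_interval[OF eps])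
  \<comment> \<open>Lebesgue measure is invariant under the reflection taking t to 1 - s -
    t.\<close>
  have g_reflect: "(\<integral>\<^sup>+ t. g (1 - (t + s)) \<partial>lborel) = ennreal (1 / \<epsilon>)" for s
    using nn_integral_real_affine[OF g_meas, of "-1" "1 - s"] g_int by (simp add: algebra_simps)
  define F where "F x = ennreal C * (g (1 - (\<Sum>j=1..<d. x j)) * (\<Prod>k=2..<d. g (x k)))" for x
  interpret P: product_sigma_finite "\<lambda>_::nat. lborel :: real measure" by standard
  have split: "{1..<d} = insert 1 {2..<d}" using d by auto
  have F_meas: "F \<in> borel_measurable (\<Pi>\<^sub>M k\<in>{1..<d}. lborel)"
  proof -
    have comp: "(\<lambda>x. x j) \<in> borel_measurable (\<Pi>\<^sub>M k\<in>{1..<d}. (lborel :: real measure))"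
      if "j \<in> {1..<d}" for j
      using measurable_component_singleton[OF that, of "\<lambda>_. lborel :: real measure"] by simp
    show ?thesis
      unfolding F_def
      by (intro borel_measurable_times_ennreal borel_measurable_const borel_measurable_prod_ennreal
          measurable_compose[OF _ g_meas] borel_measurable_diff borel_measurable_sum comp) auto
  qed
  have "GRD_const d a = (\<integral>\<^sup>+ x. ennreal (GRD_weight d a (simplex_chart d x)) *
      indicator (ordered_simplex d) (simplex_chart d x) \<partial>(\<Pi>\<^sub>M k\<in>{1..<d}. lborel))"
    by (rule GRD_const_eq[OF d])
  also have "\<dots> \<le> (\<integral>\<^sup>+ x. F x \<partial>(\<Pi>\<^sub>M k\<in>{1..<d}. lborel))"
  proof (rule nn_integral_mono)
    fix x
    define y where "y = simplex_chart d x"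
    show "ennreal (GRD_weight d a y) * indicator (ordered_simplex d) y \<le> F x"
    proof (cases "y \<in> ordered_simplex d \<and> y d \<noteq> 0")
      case False
      \<comment> \<open>On the face \<open>y d = 0\<close> the convention
        \<open>0 powr r = 0\<close> kills the weight, so the bound holds pointwise there
        too.\<close>
      have "GRD_weight d a y = 0" if "y d = 0"
        using d that by (auto simp: GRD_weight_def)
      with False show ?thesis by (auto simp: indicator_def)
    next
      case True
      then have y: "y \<in> ordered_simplex d" and yd: "0 < y d"
        using ordered_simplex_nonneg[of y d d] d by auto
      have "F x = ennreal C * (g (y d) * (\<Prod>k=2..<d. g (y k)))"
        using d by (simp add: F_def y_def simplex_chart_def)
      also have "g (y d) * (\<Prod>k=2..<d. g (y k)) = (\<Prod>k=2..d. g (y k))"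
        using d by (subst prod.last_plus) auto
      also have "\<dots> = (\<Prod>k=2..d. ennreal (y k powr (\<epsilon> - 1)))"
        using ordered_simplex_nonneg[OF y] ordered_simplex_le_1[OF y]
        by (intro prod.cong) (auto simp: g_def)
      also have "ennreal C * \<dots> = ennreal (C * (\<Prod>k=2..d. y k powr (\<epsilon> - 1)))"
        by (simp add: prod_ennreal ennreal_mult C_def prod_nonneg)
      finally show ?thesis
        using GRD_weight_le[OF d y yd tail'] y by (simp add: C_def ennreal_leI)
    qed
  qed
  also have "\<dots> = (\<integral>\<^sup>+ x. (\<integral>\<^sup>+ t. F (x(1 := t)) \<partial>lborel) \<partial>(\<Pi>\<^sub>M k\<in>{2..<d}. lborel))"
    using F_meas unfolding split by (intro P.product_nn_integral_insert) auto
  also have "\<dots> = (\<integral>\<^sup>+ x. ennreal C * ennreal (1 / \<epsilon>) * (\<Prod>k=2..<d. g (x k)) \<partial>(\<Pi>\<^sub>M k\<in>{2..<d}. lborel))"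
  proof (rule nn_integral_cong)
    fix x :: "nat \<Rightarrow> real"
    have "F (x(1 := t)) = ennreal C * (\<Prod>k=2..<d. g (x k)) * g (1 - (t + (\<Sum>j=2..<d. x j)))" for t
    proof -
      have "(\<Sum>j=1..<d. (x(1 := t)) j) = t + (\<Sum>j=2..<d. x j)"
        unfolding split by (subst sum.insert) (auto intro!: sum.cong)
      moreover have "(\<Prod>k=2..<d. g ((x(1 := t)) k)) = (\<Prod>k=2..<d. g (x k))"
        by (intro prod.cong) auto
      ultimately show ?thesis by (simp only: F_def ac_simps)
    qed
    then show "(\<integral>\<^sup>+ t. F (x(1 := t)) \<partial>lborel) = ennreal C * ennreal (1 / \<epsilon>) * (\<Prod>k=2..<d. g (x k))"
      by (simp add: nn_integral_cmult g_reflect ac_simps)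
  qed
  also have "\<dots> = ennreal C * ennreal (1 / \<epsilon>) * (\<integral>\<^sup>+ x. (\<Prod>k=2..<d. g (x k)) \<partial>(\<Pi>\<^sub>M k\<in>{2..<d}. lborel))"
  proof (rule nn_integral_cmult)
    show "(\<lambda>x. \<Prod>k=2..<d. g (x k)) \<in> borel_measurable (\<Pi>\<^sub>M k\<in>{2..<d}. lborel)"
      by measurable
  qed
  also have "(\<integral>\<^sup>+ x. (\<Prod>k=2..<d. g (x k)) \<partial>(\<Pi>\<^sub>M k\<in>{2..<d}. lborel)) = ennreal (1 / \<epsilon>) ^ (d - 2)"
    by (subst P.product_nn_integral_prod) (simp_all add: g_int)
  also have "ennreal C * ennreal (1 / \<epsilon>) * ennreal (1 / \<epsilon>) ^ (d - 2) < \<infinity>"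
    by (simp add: ennreal_mult_less_top power_less_top_ennreal)
  finally show ?thesis .
qed

section \<open>Positivity of the normalizing constant\<close>

text \<open>The intervals for \<open>Suc k\<close> and \<open>k\<close> share an endpoint, which
  forces the ordering. All of them lie above 1/d, so the last coordinate is at most 1/d. Each
  \<open>x k\<close> exceeds 1/d by at most 1/d^2, so the sum is at most (d-1)(d+1)/d^2 = 1 - 1/d^2,
  which leaves the last coordinate positive.\<close>

lemma simplex_chart_box:
  assumes d: "d \<ge> 2"
    and x: "\<And>k. k \<in> {1..<d} \<Longrightarrow>
      x k \<in> {1 / real d + real (d - k) / real d ^ 3 .. 1 / real d + real (d - k + 1) / real d ^ 3}"
  shows "simplex_chart d x \<in> ordered_simplex d" "0 < simplex_chart d x d"
proof -
  define y where "y = simplex_chart d x"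
  have y_less: "y k = x k" if "k \<in> {1..<d}" for k using that by (simp add: y_def simplex_chart_def)
  have yd: "y d = 1 - (\<Sum>j=1..<d. x j)" using d by (simp add: y_def simplex_chart_def)
  have ge: "1 / real d \<le> x k" if "k \<in> {1..<d}" for k
  proof -
    have "0 \<le> real (d - k) / real d ^ 3" by simp
    moreover have "1 / real d + real (d - k) / real d ^ 3 \<le> x k" using x[OF that] by simp
    ultimately show ?thesis by linarith
  qed
  have "(\<Sum>j=1..<d. 1 / real d) \<le> (\<Sum>j=1..<d. x j)" by (intro sum_mono ge)
  then have yd_le: "y d \<le> 1 / real d" using d by (simp add: yd field_simps of_nat_diff)
  have "x k \<le> 1 / real d + 1 / real d ^ 2" if k: "k \<in> {1..<d}" for k
  proof -
    have "real (d - k + 1) / real d ^ 3 \<le> real d / real d ^ 3"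
      using k by (intro divide_right_mono) auto
    also have "\<dots> = 1 / real d ^ 2" using d by (simp add: power2_eq_square power3_eq_cube)
    finally show ?thesis using x[OF k] by auto
  qed
  then have "(\<Sum>j=1..<d. x j) \<le> (\<Sum>j=1..<d. 1 / real d + 1 / real d ^ 2)" by (intro sum_mono)
  also have "\<dots> = 1 - 1 / real d ^ 2"
    using d by (simp add: field_simps power2_eq_square of_nat_diff)
  also have "\<dots> < 1" using d by simp
  finally have pos: "0 < y d" by (simp add: yd)
  then show "0 < simplex_chart d x d" by (simp add: y_def)
  have "y (Suc k) \<le> y k" if k: "k \<in> {1..<d}" for k
  proof (cases "Suc k = d")
    case True
    then show ?thesis using yd_le ge[OF k] y_less[OF k] by simp
  next
    case False
    then have Sk: "Suc k \<in> {1..<d}" using k by auto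
    moreover have "d - Suc k + 1 = d - k" using k by auto
    ultimately show ?thesis using x[OF k] x[OF Sk] y_less[OF k] y_less[OF Sk] by auto
  qed
  moreover have "(\<Sum>k=1..d. y k) = 1"
  proof -
    have "{1..d} = insert d {1..<d}" using d by auto
    moreover have "(\<Sum>k=1..<d. y k) = (\<Sum>k=1..<d. x k)" by (intro sum.cong) (simp_all add: y_less)
    ultimately show ?thesis by (simp add: yd)
  qed
  moreover have "y \<in> {1..d} \<rightarrow>\<^sub>E UNIV" by (simp add: y_def simplex_chart_def)
  ultimately show "simplex_chart d x \<in> ordered_simplex d"
    using pos by (auto simp: ordered_simplex_def y_def)
qed

text \<open>A vanishing integral would make the integrand zero almost everywhere, but it is nonzero
  throughout the box of \<open>simplex_chart_box\<close>, whose product measure is positive.\<close>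

lemma GRD_const_pos:
  assumes d: "d \<ge> 2"
  shows "0 < GRD_const d a"
proof (rule ccontr)
  interpret P: product_sigma_finite "\<lambda>_::nat. lborel :: real measure" by standard
  let ?P = "\<Pi>\<^sub>M k\<in>{1..<d}. (lborel :: real measure)"
  let ?w = "\<lambda>x. ennreal (GRD_weight d a (simplex_chart d x)) *
    indicator (ordered_simplex d) (simplex_chart d x)"
  define I where
    "I k = {1 / real d + real (d - k) / real d ^ 3 .. 1 / real d + real (d - k + 1) / real d ^ 3}" for k
  define B where "B = Pi\<^sub>E {1..<d} I"
  note [measurable] = measurable_GRD_weight measurable_simplex_chart ordered_simplex_in_sets[OF d]
  have w_meas: "?w \<in> borel_measurable ?P" by measurable
  assume "\<not> 0 < GRD_const d a"
  then have "(\<integral>\<^sup>+ x. ?w x \<partial>?P) = 0"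
    by (simp only: GRD_const_eq[OF d] not_gr_zero)
  then have AE: "AE x in ?P. ?w x = 0"
    by (simp only: nn_integral_0_iff_AE[OF w_meas])
  have "?w x \<noteq> 0" if "x \<in> B" for x
  proof -
    have x: "x k \<in> I k" if "k \<in> {1..<d}" for k using \<open>x \<in> B\<close> that by (auto simp: B_def)
    note S = simplex_chart_box[OF d x[unfolded I_def]]
    have "0 < simplex_chart d x k" if "k \<in> {1..d}" for k
      using ordered_simplex_antimono[OF S(1), of k d] S(2) that by auto
    then have "0 < GRD_weight d a (simplex_chart d x)"
      unfolding GRD_weight_def by (intro prod_pos) (auto simp: order_less_le)
    with S(1) show ?thesis by simp
  qed
  then have "AE x in ?P. x \<notin> B" using AE by (auto elim: eventually_mono)
  moreover have B_sets: "B \<in> sets ?P" unfolding B_def I_def by (intro sets_PiM_I_finite) auto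
  ultimately have "emeasure ?P B = 0"
    using AE_iff_null_sets by blast
  moreover have "emeasure ?P B = (\<Prod>k\<in>{1..<d}. emeasure lborel (I k))"
    unfolding B_def by (intro P.emeasure_PiM) (auto simp: I_def)
  \<comment> \<open>In \<open>d - k + 1\<close> the truncated subtraction is done first, so every
    \<open>I k\<close> has length 1/d^3.\<close>
  moreover have "emeasure lborel (I k) \<noteq> 0" for k
  proof -
    have "real (d - k) / real d ^ 3 < real (d - k + 1) / real d ^ 3"
      using d by (intro divide_strict_right_mono) auto
    then show ?thesis using d by (simp add: I_def)
  qed
  ultimately show False by simp
qed

section \<open>Change of parameter\<close>

theorem theorem6:
  fixes d :: nat and a b :: "nat \<Rightarrow> real" and f :: "(nat \<Rightarrow> real) \<Rightarrow> real"
  assumes "d \<ge> 2"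
    and "\<And>k. k \<in> {2..d} \<Longrightarrow> tail_sum d a k > 0"
    and "\<And>k. k \<in> {2..d} \<Longrightarrow> tail_sum d b k > 0"
    and "integrable (GRD d a) f"
  shows "integrable (GRD d b) (\<lambda>y. f y * (\<Prod>k=1..d. y k powr (a k - b k))) \<and>
    integrable (GRD d b) (\<lambda>y. \<Prod>k=1..d. y k powr (a k - b k)) \<and>
    (\<integral>y. (\<Prod>k=1..d. y k powr (a k - b k)) \<partial>GRD d b) \<noteq> 0 \<and>
    (\<integral>y. f y \<partial>GRD d a) =
      (\<integral>y. f y * (\<Prod>k=1..d. y k powr (a k - b k)) \<partial>GRD d b) /
      (\<integral>y. (\<Prod>k=1..d. y k powr (a k - b k)) \<partial>GRD d b)"
proof -
  let ?M = "simplex_measure d" and ?w = "GRD_weight d"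
  define h where "h y = (\<Prod>k=1..d. y k powr (a k - b k))" for y :: "nat \<Rightarrow> real"
  define q where "q c = enn2real (GRD_const d c)" for c
  have const: "GRD_const d c = ennreal (q c)" "0 < q c" if "c \<in> {a, b}" for c
    using GRD_const_finite[OF assms(1)] assms(2,3) GRD_const_pos[OF assms(1)] that
    by (auto simp: q_def enn2real_positive_iff)
  have w_meas[measurable]: "?w c \<in> borel_measurable ?M" for c
    by (intro measurable_simplex_measure measurable_GRD_weight)
  have h_meas[measurable]: "h \<in> borel_measurable ?M"
    unfolding h_def
    by (intro measurable_simplex_measure borel_measurable_prod powr_real_measurable
        borel_measurable_const measurable_component_singleton)
  have f_meas[measurable]: "f \<in> borel_measurable ?M"
    using borel_measurable_integrable[OF assms(4)] by (simp add: GRD_def)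
  have dens: "GRD d c = density ?M (\<lambda>y. ennreal (?w c y / q c))" if "c \<in> {a, b}" for c
    using const[OF that] by (simp add: GRD_def divide_ennreal GRD_weight_nonneg)
  \<comment> \<open>With positive finite constants, the quotient in the density is a real one, and
    both laws reduce to weighted integrals over the same measure.\<close>
  have integrable: "integrable (GRD d c) u \<longleftrightarrow> integrable ?M (\<lambda>y. ?w c y * u y)"
    and integral: "(\<integral>y. u y \<partial>GRD d c) = (\<integral>y. ?w c y * u y \<partial>?M) / q c"
    if "c \<in> {a, b}" and [measurable]: "u \<in> borel_measurable ?M" for c u
    using const(2)[OF that(1)] integrable_mult_left_iff[of ?M "1 / q c" "\<lambda>y. ?w c y * u y"]
    by (simp_all add: dens[OF that(1)] integrable_density integral_density GRD_weight_nonneg)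
  \<comment> \<open>The factor \<open>h\<close> turns the weight of \<open>b\<close> into that of
    \<open>a\<close>; hence the denominator will be \<open>q a / q b\<close>.\<close>
  have wh: "?w b y * h y = ?w a y" if "y \<in> space ?M" for y
    using GRD_weight_mult_powr[of y d b a] that by (simp add: h_def space_simplex_measure)
  have "(\<integral>\<^sup>+ y. ennreal (?w a y) \<partial>?M) = ennreal (q a)"
    using const(1)[of a] by (simp add: GRD_const_def)
  then have w_int: "integrable ?M (?w a)" and w_integral: "(\<integral>y. ?w a y \<partial>?M) = q a"
    using const(2)[of a]
    by (simp_all add: integrable_iff_bounded GRD_weight_nonneg integral_eq_nn_integral)
  have h_int: "integrable (GRD d b) h"
    using w_int by (simp add: integrable wh cong: Bochner_Integration.integrable_cong)
  have h_integral: "(\<integral>y. h y \<partial>GRD d b) = q a / q b"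
    by (simp add: integral wh w_integral cong: Bochner_Integration.integral_cong)
  have wfh: "?w b y * (f y * h y) = ?w a y * f y" if "y \<in> space ?M" for y
    using wh[OF that] by (simp add: mult.left_commute mult.commute)
  have "integrable (GRD d b) (\<lambda>y. f y * h y)"
    using assms(4) by (simp add: integrable wfh cong: Bochner_Integration.integrable_cong)
  moreover note h_int
  moreover have "(\<integral>y. f y * h y \<partial>GRD d b) = (\<integral>y. ?w a y * f y \<partial>?M) / q b"
    by (simp add: integral wfh cong: Bochner_Integration.integral_cong)
  moreover have "(\<integral>y. f y \<partial>GRD d a) = (\<integral>y. ?w a y * f y \<partial>?M) / q a"
    by (simp add: integral)
  \<comment> \<open>With I the integral of \<open>?w a y * f y\<close>, the quotient is (I / q b) /
    (q a / q b) = I / q a.\<close>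
  ultimately show ?thesis
    using const(2)[of a] const(2)[of b] unfolding h_def[symmetric] by (simp only: h_integral) simp
qed

end
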